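(* Let $X$ be a reflexive Banach space and let $Z$ be a Hausdorff topological vector space. Let $C\subseteq Z$ be a convex and pointed cone with nonempty interior, and let $K$ be a nonempty, convex and closed subset of $X$. Consider a mapping $F:K\times K\times K\to Z$ satisfying: (i) for every $y\in K$, one of the following conditions is satisfied with respect to the weak topology of $X$ (that is, convergence of nets in $K$ and neighborhoods of points of $K$ are taken in the weak topology): (a) for every net $(x_\alpha)\subseteq K$ with $\lim x_\alpha=x$: if $F(x_\alpha,y,x_\alpha)\notin-\operatorname{int}C$ for all $\alpha$, then $F(x,y,x)\notin-\operatorname{int}C$; (b) the mapping $x\mapsto F(x,y,x)$ is $C$-upper semicontinuous on $K$; (c) for every $x\in K$ and every net $(x_\alpha)\subseteq K$ with $\lim x_\alpha=x$ there exists a net $(z_\alpha)\subseteq Z$ with $\lim z_\alpha=z$ such that $F(x_\alpha,y,x_\alpha)-z_\alpha\in-C$ and $F(x,y,x)-z\in C$; (ii) for every $x\in K$, the mapping $y\mapsto F(x,y,x)$ is $C$-convex; (iii) for every $x\in K$, $F(x,x,x)\notin-\operatorname{int}C$; (iv) there exists $r>0$ such that, for all $x\in K$ with $\|x\|\le r$, there exists $y_0\in K$ with $\|y_0\|<r$ and $F(x,y_0,x)\in-C$. Then there exists an element $x_0\in K$ such that $F(x_0,y,x_0)\notin-\operatorname{int}C$ for all $y\in K$.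
   Context: All spaces are real. A cone $C$ satisfies $tc\in C$ for all $c\in C$, $t\ge 0$; it is convex if $C+C=C$ and pointed if $C\cap(-C)=\{0\}$. $\operatorname{int}C$ is the interior of $C$. A map $f:K\to Z$ is $C$-upper semicontinuous at $x\in K$ if for any neighborhood $V$ of $f(x)$ there exists a neighborhood $U$ of $x$ such that $f(u)\in V-C$ for all $u\in U\cap K$; it is $C$-upper semicontinuous on $K$ if this holds at every $x\in K$. A map $f:K\to Z$ ($K$ convex) is $C$-convex if $tf(x)+(1-t)f(y)-f(tx+(1-t)y)\in C$ for all $x,y\in K$, $t\in[0,1]$.
   Formalization: In (iv) the formal statement also requires that K contains a point with ‖x‖ ≤ r for the same r; otherwise (iv) may be vacuous and the claim fails, e.g. X=Z=ℝ, C=[0,∞), K=[1,∞), F(x,y,z)=x−y, r=1/2. *)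

theory Defs
  imports "HOL-Analysis.Analysis"
begin

class topological_real_vector = topological_ab_group_add + real_vector +
  assumes tendsto_scaleR_Pair:
    "LIM p (nhds t \<times>\<^sub>F nhds z). fst p *\<^sub>R snd p :> nhds (t *\<^sub>R z)"

text \<open>The canonical embedding into the bidual (bounded functionals) is onto. The type argument
  only carries the space.\<close>

definition reflexive_space :: "'a::real_normed_vector itself \<Rightarrow> bool" where
  "reflexive_space _ \<longleftrightarrow>
     (\<forall>\<Phi> :: ('a \<Rightarrow>\<^sub>L real) \<Rightarrow>\<^sub>L real. \<exists>x::'a. \<forall>f. blinfun_apply \<Phi> f = blinfun_apply f x)"

definition weak_topology :: "'a::real_normed_vector topology" where
  "weak_topology =
     topology_generated_by {blinfun_apply f -` U | (f :: 'a \<Rightarrow>\<^sub>L real) U. open U}"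

text \<open>In what follows \<open>uminus ` A\<close> is the pointwise negative of a set \<open>A\<close>; \<open>- A\<close> would be its
  complement. A convex cone is a cone with \<open>C + C = C\<close>.\<close>

definition pointed_convex_cone :: "'z::real_vector set \<Rightarrow> bool" where
  "pointed_convex_cone C \<longleftrightarrow>
     cone C \<and> {c + d | c d. c \<in> C \<and> d \<in> C} = C \<and> C \<inter> uminus ` C = {0}"

definition C_convex_on :: "'z::real_vector set \<Rightarrow> 'a::real_vector set \<Rightarrow> ('a \<Rightarrow> 'z) \<Rightarrow> bool" where
  "C_convex_on C K g \<longleftrightarrow>
     (\<forall>x\<in>K. \<forall>y\<in>K. \<forall>t\<in>{0..1}.
        t *\<^sub>R g x + (1 - t) *\<^sub>R g y - g (t *\<^sub>R x + (1 - t) *\<^sub>R y) \<in> C)"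

definition C_usc_on ::
    "'a topology \<Rightarrow> 'z::{topological_space, minus} set \<Rightarrow> 'a set \<Rightarrow> ('a \<Rightarrow> 'z) \<Rightarrow> bool" where
  "C_usc_on T C K g \<longleftrightarrow>
     (\<forall>x\<in>K. \<forall>V. open V \<and> g x \<in> V \<longrightarrow>
        (\<exists>U. openin T U \<and> x \<in> U \<and> (\<forall>u\<in>U \<inter> K. g u \<in> {v - c | v c. v \<in> V \<and> c \<in> C})))"

text \<open>A net is a function on a directed preordered set \<open>D\<close>, a subset of some index type.\<close>

definition directed_set :: "'i set \<Rightarrow> ('i \<Rightarrow> 'i \<Rightarrow> bool) \<Rightarrow> bool" where
  "directed_set D le \<longleftrightarrow>
     D \<noteq> {} \<and> reflp_on D le \<and> transp_on D le \<and>
     (\<forall>\<alpha>\<in>D. \<forall>\<beta>\<in>D. \<exists>\<gamma>\<in>D. le \<alpha> \<gamma> \<and> le \<beta> \<gamma>)"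

definition net_filter :: "'i set \<Rightarrow> ('i \<Rightarrow> 'i \<Rightarrow> bool) \<Rightarrow> 'i filter" where
  "net_filter D le = (INF \<alpha>\<in>D. principal {\<beta>\<in>D. le \<alpha> \<beta>})"

lemma eventually_net_filter:
  assumes "directed_set D le"
  shows "eventually P (net_filter D le) \<longleftrightarrow> (\<exists>\<alpha>\<in>D. \<forall>\<beta>\<in>D. le \<alpha> \<beta> \<longrightarrow> P \<beta>)"
proof -
  have ne: "D \<noteq> {}" and trans: "transp_on D le"
    and dir: "\<And>\<alpha> \<beta>. \<alpha> \<in> D \<Longrightarrow> \<beta> \<in> D \<Longrightarrow> \<exists>\<gamma>\<in>D. le \<alpha> \<gamma> \<and> le \<beta> \<gamma>"
    using assms unfolding directed_set_def by simp_all
  have base: "\<exists>\<gamma>\<in>D. principal {\<delta>\<in>D. le \<gamma> \<delta>} \<le>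
          inf (principal {\<delta>\<in>D. le \<alpha> \<delta>}) (principal {\<delta>\<in>D. le \<beta> \<delta>})"
    if \<alpha>: "\<alpha> \<in> D" and \<beta>: "\<beta> \<in> D" for \<alpha> \<beta>
  proof -
    obtain \<gamma> where \<gamma>: "\<gamma> \<in> D" "le \<alpha> \<gamma>" "le \<beta> \<gamma>"
      using dir[OF \<alpha> \<beta>] by blast
    have "{\<delta>\<in>D. le \<gamma> \<delta>} \<subseteq> {\<delta>\<in>D. le \<alpha> \<delta>} \<inter> {\<delta>\<in>D. le \<beta> \<delta>}"
      using transp_onD[OF trans \<alpha> \<gamma>(1) _ \<gamma>(2)] transp_onD[OF trans \<beta> \<gamma>(1) _ \<gamma>(3)] by blast
    then show ?thesis
      by (intro bexI[OF _ \<gamma>(1)]) (simp only: inf_principal principal_le_iff)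
  qed
  show ?thesis
    unfolding net_filter_def by (subst eventually_INF_base[OF ne base]) (auto simp: eventually_principal)
qed

text \<open>HOL cannot quantify over index types inside a formula, so the next two conditions take the
  index type as an argument. With \<open>'a \<times> 'a set\<close> as index type they cover all nets whatsoever:
  see \<open>net_closed_any_index\<close> and \<open>net_C_bounded_any_index\<close> below.\<close>

definition net_closed ::
    "'i itself \<Rightarrow> 'a topology \<Rightarrow> 'z::{topological_space, uminus} set \<Rightarrow> 'a set \<Rightarrow> ('a \<Rightarrow> 'z) \<Rightarrow> bool"
  where
  "net_closed _ T C K g \<longleftrightarrow>
     (\<forall>(D :: 'i set) le x. \<forall>l\<in>K.
        directed_set D le \<and> (\<forall>\<alpha>\<in>D. x \<alpha> \<in> K) \<and> limitin T x l (net_filter D le) \<and>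
        (\<forall>\<alpha>\<in>D. g (x \<alpha>) \<notin> uminus ` interior C)
        \<longrightarrow> g l \<notin> uminus ` interior C)"

definition net_C_bounded ::
    "'i itself \<Rightarrow> 'a topology \<Rightarrow> 'z::{topological_space, minus, uminus} set \<Rightarrow> 'a set
      \<Rightarrow> ('a \<Rightarrow> 'z) \<Rightarrow> bool"
  where
  "net_C_bounded _ T C K g \<longleftrightarrow>
     (\<forall>(D :: 'i set) le x. \<forall>l\<in>K.
        directed_set D le \<and> (\<forall>\<alpha>\<in>D. x \<alpha> \<in> K) \<and> limitin T x l (net_filter D le)
        \<longrightarrow> (\<exists>z z0. (z \<longlongrightarrow> z0) (net_filter D le) \<and>
               (\<forall>\<alpha>\<in>D. g (x \<alpha>) - z \<alpha> \<in> uminus ` C) \<and> g l - z0 \<in> C))"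

text \<open>Every net \<open>x\<close> factors through the net \<open>fst\<close> indexed by the pairs \<open>(p, A)\<close>, where \<open>A\<close> is
  the image of a tail of \<open>x\<close> and \<open>p \<in> A\<close>, ordered by reverse inclusion of the second component.\<close>

lemma net_factor:
  fixes x :: "'i \<Rightarrow> 'a"
  assumes dir: "directed_set D le"
  obtains D' :: "('a \<times> 'a set) set" and le' h
  where "directed_set D' le'" "fst ` D' \<subseteq> x ` D" "h ` D \<subseteq> D'" "\<forall>\<alpha>. fst (h \<alpha>) = x \<alpha>"
    "filterlim h (net_filter D' le') (net_filter D le)"
    "\<forall>T l. limitin T x l (net_filter D le) \<longrightarrow> limitin T fst l (net_filter D' le')"
proof -
  define tl where "tl \<alpha> = x ` {\<beta>\<in>D. le \<alpha> \<beta>}" for \<alpha>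
  define D' where "D' = {(p, A). \<exists>\<alpha>\<in>D. A = tl \<alpha> \<and> p \<in> A}"
  define le' where "le' a b \<longleftrightarrow> snd b \<subseteq> snd a" for a b :: "'a \<times> 'a set"
  define h where "h \<alpha> = (x \<alpha>, tl \<alpha>)" for \<alpha>
  have refl: "le \<alpha> \<alpha>" if "\<alpha> \<in> D" for \<alpha>
    using dir that reflp_onD[of D le \<alpha>] by (simp add: directed_set_def)
  have mono: "tl \<beta> \<subseteq> tl \<alpha>" if "\<alpha> \<in> D" "\<beta> \<in> D" "le \<alpha> \<beta>" for \<alpha> \<beta>
  proof -
    have "transp_on D le" using dir by (simp add: directed_set_def)
    then show ?thesis
      using that transp_onD[of D le \<alpha> \<beta>] unfolding tl_def by blast
  qed
  have hD: "h \<alpha> \<in> D'" if "\<alpha> \<in> D" for \<alpha>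
    using refl that unfolding h_def D'_def tl_def by auto
  have D'E: "\<exists>\<alpha>\<in>D. snd a = tl \<alpha>" "fst a \<in> snd a" if "a \<in> D'" for a
    using that unfolding D'_def by auto
  have dir': "directed_set D' le'"
    unfolding directed_set_def
  proof (intro conjI ballI)
    show "D' \<noteq> {}" using dir hD unfolding directed_set_def by blast
    show "reflp_on D' le'" by (auto simp: reflp_on_def le'_def)
    show "transp_on D' le'" by (auto simp: transp_on_def le'_def)
    fix a b assume "a \<in> D'" "b \<in> D'"
    then obtain \<alpha> \<beta> where ab: "\<alpha> \<in> D" "\<beta> \<in> D" "snd a = tl \<alpha>" "snd b = tl \<beta>"
      using D'E by meson
    obtain \<gamma> where "\<gamma> \<in> D" "le \<alpha> \<gamma>" "le \<beta> \<gamma>"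
      using dir ab unfolding directed_set_def by blast
    then show "\<exists>c\<in>D'. le' a c \<and> le' b c"
      using ab mono hD[of \<gamma>] by (intro bexI[of _ "h \<gamma>"]) (auto simp: le'_def h_def)
  qed
  show thesis
  proof
    show "directed_set D' le'" by (rule dir')
    show "fst ` D' \<subseteq> x ` D" using D'E by (fastforce simp: tl_def)
    show "h ` D \<subseteq> D'" using hD by blast
    show "\<forall>\<alpha>. fst (h \<alpha>) = x \<alpha>" by (simp add: h_def)
    show "filterlim h (net_filter D' le') (net_filter D le)"
      unfolding filterlim_iff
    proof (intro allI impI)
      fix P assume "eventually P (net_filter D' le')"
      then obtain a where a: "a \<in> D'" "\<And>b. b \<in> D' \<Longrightarrow> le' a b \<Longrightarrow> P b"
        using eventually_net_filter[OF dir'] by blast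
      obtain \<alpha> where "\<alpha> \<in> D" "snd a = tl \<alpha>" using D'E a(1) by blast
      then have "\<forall>\<beta>\<in>D. le \<alpha> \<beta> \<longrightarrow> P (h \<beta>)"
        using a(2) hD mono by (auto simp: le'_def h_def)
      then show "\<forall>\<^sub>F \<beta> in net_filter D le. P (h \<beta>)"
        using eventually_net_filter[OF dir] \<open>\<alpha> \<in> D\<close> by blast
    qed
    have "limitin T fst l (net_filter D' le')" if lim: "limitin T x l (net_filter D le)" for T l
      unfolding limitin_def
    proof (intro conjI allI impI)
      show "l \<in> topspace T" using lim by (simp add: limitin_def)
      fix U assume "openin T U \<and> l \<in> U"
      then have "\<forall>\<^sub>F \<alpha> in net_filter D le. x \<alpha> \<in> U"
        using lim by (simp add: limitin_def)
      then obtain \<alpha> where \<alpha>: "\<alpha> \<in> D" "\<forall>\<beta>\<in>D. le \<alpha> \<beta> \<longrightarrow> x \<beta> \<in> U"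
        unfolding eventually_net_filter[OF dir] by (elim bexE)
      have "tl \<alpha> \<subseteq> U" using \<alpha>(2) by (auto simp: tl_def)
      then have "fst a \<in> U" if "a \<in> D'" "le' (h \<alpha>) a" for a
        using D'E(2)[OF that(1)] that(2) unfolding le'_def h_def snd_conv by (meson subsetD)
      then show "\<forall>\<^sub>F a in net_filter D' le'. fst a \<in> U"
        unfolding eventually_net_filter[OF dir'] using hD[OF \<alpha>(1)] by (intro bexI[of _ "h \<alpha>"]) simp_all
    qed
    then show "\<forall>T l. limitin T x l (net_filter D le) \<longrightarrow> limitin T fst l (net_filter D' le')"
      by blast
  qed
qed

lemma net_closed_any_index:
  assumes "net_closed TYPE('a \<times> 'a set) T C K g"
  shows "net_closed TYPE('i) T C (K :: 'a set) g"
  unfolding net_closed_def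
proof (intro allI ballI impI)
  fix D :: "'i set" and le x l
  assume l: "l \<in> K" and *: "directed_set D le \<and> (\<forall>\<alpha>\<in>D. x \<alpha> \<in> K) \<and>
    limitin T x l (net_filter D le) \<and> (\<forall>\<alpha>\<in>D. g (x \<alpha>) \<notin> uminus ` interior C)"
  from * have dir: "directed_set D le" by blast
  obtain D' :: "('a \<times> 'a set) set" and le' h
    where D': "directed_set D' le'" "fst ` D' \<subseteq> x ` D" "h ` D \<subseteq> D'" "\<forall>\<alpha>. fst (h \<alpha>) = x \<alpha>"
      "filterlim h (net_filter D' le') (net_filter D le)"
      "\<forall>T l. limitin T x l (net_filter D le) \<longrightarrow> limitin T fst l (net_filter D' le')"
    by (rule net_factor[OF dir, of x])
  have "\<forall>a\<in>D'. fst a \<in> K" "\<forall>a\<in>D'. g (fst a) \<notin> uminus ` interior C"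
    using * D'(2) by (fastforce simp: image_subset_iff)+
  moreover have "limitin T fst l (net_filter D' le')" using * D'(6) by blast
  ultimately show "g l \<notin> uminus ` interior C"
    using assms l D'(1) unfolding net_closed_def by blast
qed

lemma net_C_bounded_any_index:
  assumes "net_C_bounded TYPE('a \<times> 'a set) T C K g"
  shows "net_C_bounded TYPE('i) T C (K :: 'a set) g"
  unfolding net_C_bounded_def
proof (intro allI ballI impI)
  fix D :: "'i set" and le x l
  assume l: "l \<in> K" and *: "directed_set D le \<and> (\<forall>\<alpha>\<in>D. x \<alpha> \<in> K) \<and>
    limitin T x l (net_filter D le)"
  from * have dir: "directed_set D le" by blast
  obtain D' :: "('a \<times> 'a set) set" and le' h
    where D': "directed_set D' le'" "fst ` D' \<subseteq> x ` D" "h ` D \<subseteq> D'" "\<forall>\<alpha>. fst (h \<alpha>) = x \<alpha>"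
      "filterlim h (net_filter D' le') (net_filter D le)"
      "\<forall>T l. limitin T x l (net_filter D le) \<longrightarrow> limitin T fst l (net_filter D' le')"
    by (rule net_factor[OF dir, of x])
  have "\<forall>a\<in>D'. fst a \<in> K" using * D'(2) by (fastforce simp: image_subset_iff)
  moreover have "limitin T fst l (net_filter D' le')" using * D'(6) by blast
  ultimately obtain z z0 where z: "(z \<longlongrightarrow> z0) (net_filter D' le')"
      "\<forall>a\<in>D'. g (fst a) - z a \<in> uminus ` C" "g l - z0 \<in> C"
    using assms l D'(1) unfolding net_C_bounded_def by blast
  have "((\<lambda>\<alpha>. z (h \<alpha>)) \<longlongrightarrow> z0) (net_filter D le)"
    using z(1) D'(5) by (rule filterlim_compose)
  moreover have "\<forall>\<alpha>\<in>D. g (x \<alpha>) - z (h \<alpha>) \<in> uminus ` C"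
    using z(2) D'(3,4) by (metis image_subset_iff)
  ultimately show "\<exists>z z0. (z \<longlongrightarrow> z0) (net_filter D le) \<and>
      (\<forall>\<alpha>\<in>D. g (x \<alpha>) - z \<alpha> \<in> uminus ` C) \<and> g l - z0 \<in> C"
    using z(3) by blast
qed

end

theory Submission
  imports Defs
begin

text \<open>
  Call \<open>z\<close> strictly negative if it lies in \<open>uminus ` interior C\<close>, and say that \<open>y\<close> beats \<open>x\<close> if
  \<open>F x y x\<close> is strictly negative. The theorem asks for a point of \<open>K\<close> that no point of \<open>K\<close> beats.

  First restrict to \<open>M = K \<inter> cball 0 r\<close>, which is weakly compact because the space is reflexive
  (\<open>reflexive_weakly_compact\<close>). The points that beat a given \<open>x\<close> form a convex set by \<open>C\<close>-convexity,
  since \<open>interior C\<close> absorbs addition of \<open>C\<close> and positive scaling; no point beats itself; and each of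
  the three alternatives in the first hypothesis makes the set of points beaten by a fixed \<open>y\<close> weakly
  open relative to \<open>K\<close>. The theorem of Browder and Fan (\<open>Browder_Fan_maximal_element\<close>) then gives
  \<open>x0 \<in> M\<close> that no point of \<open>M\<close> beats. It comes from Brouwer's fixed point theorem through a covering
  property of simplices (\<open>simplex_open_cover\<close>).

  Coercivity removes the restriction to \<open>M\<close>: it supplies \<open>y0 \<in> K\<close> with \<open>norm y0 < r\<close> and
  \<open>F x0 y0 x0 \<in> uminus ` C\<close>. If some \<open>y \<in> K\<close> beat \<open>x0\<close>, then so would every point of the segment from
  \<open>y0\<close> to \<open>y\<close> other than \<open>y0\<close> itself, and those close to \<open>y0\<close> lie in \<open>M\<close>.

  Weak compactness rests on Tychonoff's theorem and on the separation of a point from a closed convex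
  set by a bounded functional (\<open>Hahn_Banach_separation\<close>). The latter is obtained from a sublinear
  function made from the norm and the distance to the set, and from the fact that minimal sublinear
  functions are linear.
\<close>

section \<open>Brouwer's theorem on cubes of variable dimension\<close>

text \<open>Points of the \<open>n\<close>-dimensional cube are sequences that vanish from index \<open>n\<close> on, so that
  \<open>n\<close> is a term: the theorem is applied with as many coordinates as a finite subcover has members.
  The product topology on \<^typ>\<open>nat \<Rightarrow> real\<close> is metrizable and induces the usual topology on the
  cube.\<close>

definition unit_cube :: "nat \<Rightarrow> (nat \<Rightarrow> real) set" where
  "unit_cube n = {x. (\<forall>i<n. 0 \<le> x i \<and> x i \<le> 1) \<and> (\<forall>i\<ge>n. x i = 0)}"

lemma compact_unit_cube: "compact (unit_cube n)"
proof -
  have "unit_cube n = Pi\<^sub>E UNIV (\<lambda>i. if i < n then {0..1} else {0})"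
    by (auto simp: unit_cube_def PiE_iff not_less) (metis atLeastAtMost_iff singletonD not_less)+
  moreover have "compactin (product_topology (\<lambda>_. euclidean) UNIV)
      (Pi\<^sub>E UNIV (\<lambda>i::nat. if i < n then {0..1::real} else {0}))"
    by (subst compactin_PiE) auto
  ultimately show ?thesis
    by (simp add: euclidean_product_topology)
qed

text \<open>Kuhn's combinatorial lemma, applied on the grid of mesh \<open>1/p\<close>, gives a grid cube which has, for
  each coordinate \<open>i\<close>, a vertex where \<open>f\<close> does not decrease coordinate \<open>i\<close> and another one where it
  does not increase it. As \<open>p\<close> grows these cubes shrink, along a subsequence, to a point, and by
  continuity no coordinate of that point is moved.\<close>
theorem Brouwer_unit_cube:
  assumes cont: "continuous_on (unit_cube n) f" and maps: "f ` unit_cube n \<subseteq> unit_cube n"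
  obtains x where "x \<in> unit_cube n" "f x = x"
proof -
  define pt where "pt p x = (\<lambda>i. if i < n then real (x i) / real p else 0)" for p :: nat and x
  have pt_cube: "pt p x \<in> unit_cube n" if "0 < p" "\<forall>i<n. x i \<le> p" for p x
    using that by (auto simp: pt_def unit_cube_def)
  have f_range: "0 \<le> f x i \<and> f x i \<le> 1" if "x \<in> unit_cube n" "i < n" for x i
  proof -
    have "f x \<in> unit_cube n" using maps that by blast
    then show ?thesis using that by (simp add: unit_cube_def)
  qed
  \<comment> \<open>Label 0 means that coordinate \<open>i\<close> does not decrease under \<open>f\<close>, label 1 that it does not increase.\<close>
  define label where
    "label p x i = (if x i \<noteq> p \<and> pt p x i \<le> f (pt p x) i then 0 else 1::nat)" for p x i
  have grid: "\<exists>q. (\<forall>i<n. q i < p) \<and> (\<forall>i<n. \<exists>r s.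
      (\<forall>j<n. q j \<le> r j \<and> r j \<le> q j + 1) \<and> (\<forall>j<n. q j \<le> s j \<and> s j \<le> q j + 1) \<and>
      label p r i = 0 \<and> label p s i = 1)" if p: "0 < p" for p
  proof -
    have lab0: "label p x i = 0" if "\<forall>i<n. x i \<le> p" "i < n" "x i = 0" for x i
      using that p f_range[OF pt_cube[OF p that(1)] that(2)] by (simp add: label_def pt_def)
    have lab1: "label p x i = 1" if "x i = p" for x i
      using that by (simp add: label_def)
    have lab01: "label p x i = 0 \<or> label p x i = 1" for x i
      by (simp add: label_def)
    obtain q where "\<forall>i<n. q i < p" and
      q: "\<forall>i<n. \<exists>r s. (\<forall>j<n. q j \<le> r j \<and> r j \<le> q j + 1) \<and>
        (\<forall>j<n. q j \<le> s j \<and> s j \<le> q j + 1) \<and> label p r i \<noteq> label p s i"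
    proof (rule kuhn_lemma[of p n "label p"])
      show "0 < p" by (rule p)
      show "\<forall>x. (\<forall>i<n. x i \<le> p) \<longrightarrow> (\<forall>i<n. label p x i = 0 \<or> label p x i = 1)"
        using lab01 by blast
      show "\<forall>x. (\<forall>i<n. x i \<le> p) \<longrightarrow> (\<forall>i<n. x i = 0 \<longrightarrow> label p x i = 0)"
        using lab0 by blast
      show "\<forall>x. (\<forall>i<n. x i \<le> p) \<longrightarrow> (\<forall>i<n. x i = p \<longrightarrow> label p x i = 1)"
        using lab1 by blast
    qed
    moreover have "\<forall>i<n. \<exists>r s. (\<forall>j<n. q j \<le> r j \<and> r j \<le> q j + 1) \<and>
        (\<forall>j<n. q j \<le> s j \<and> s j \<le> q j + 1) \<and> label p r i = 0 \<and> label p s i = 1"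
      using q lab01 by metis
    ultimately show ?thesis by blast
  qed
  have "\<forall>k. \<exists>q. (\<forall>i<n. q i < Suc k) \<and> (\<forall>i<n. \<exists>r s.
      (\<forall>j<n. q j \<le> r j \<and> r j \<le> q j + 1) \<and> (\<forall>j<n. q j \<le> s j \<and> s j \<le> q j + 1) \<and>
      label (Suc k) r i = 0 \<and> label (Suc k) s i = 1)"
    using grid by blast
  then obtain q where q: "\<And>k i. i < n \<Longrightarrow> q k i < Suc k"
    and "\<forall>k. \<forall>i<n. \<exists>r s. (\<forall>j<n. q k j \<le> r j \<and> r j \<le> q k j + 1) \<and>
      (\<forall>j<n. q k j \<le> s j \<and> s j \<le> q k j + 1) \<and> label (Suc k) r i = 0 \<and> label (Suc k) s i = 1"
    by metis
  then obtain r s where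
    r: "\<And>k i j. i < n \<Longrightarrow> j < n \<Longrightarrow> q k j \<le> r k i j \<and> r k i j \<le> q k j + 1" and
    s: "\<And>k i j. i < n \<Longrightarrow> j < n \<Longrightarrow> q k j \<le> s k i j \<and> s k i j \<le> q k j + 1" and
    r0: "\<And>k i. i < n \<Longrightarrow> label (Suc k) (r k i) i = 0" and
    s1: "\<And>k i. i < n \<Longrightarrow> label (Suc k) (s k i) i = 1"
    by metis
  have "pt (Suc k) (q k) \<in> unit_cube n" for k
    using q by (intro pt_cube) (auto intro: less_imp_le)
  moreover have "seq_compact (unit_cube n)"
    by (simp add: compact_unit_cube compact_imp_seq_compact)
  ultimately obtain z \<sigma> where z: "z \<in> unit_cube n" and \<sigma>: "strict_mono \<sigma>"
    and lim: "((\<lambda>k. pt (Suc k) (q k)) \<circ> \<sigma>) \<longlonglongrightarrow> z"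
    using seq_compactE[of "unit_cube n" "\<lambda>k. pt (Suc k) (q k)"] by blast
  have inv: "(\<lambda>k. 1 / real (Suc (\<sigma> k))) \<longlonglongrightarrow> 0"
    using LIMSEQ_subseq_LIMSEQ[OF LIMSEQ_Suc[OF lim_const_over_n[of "1::real"]] \<sigma>] by (simp add: comp_def)
  have coord: "(\<lambda>k. x k j) \<longlonglongrightarrow> l j" if "x \<longlonglongrightarrow> l" for x :: "nat \<Rightarrow> nat \<Rightarrow> real" and l j
    using that limitin_componentwise[of "\<lambda>_. euclideanreal" UNIV x l sequentially]
    by (simp add: euclidean_product_topology)
  have limI: "x \<longlonglongrightarrow> l" if "\<And>j. (\<lambda>k. x k j) \<longlonglongrightarrow> l j" for x :: "nat \<Rightarrow> nat \<Rightarrow> real" and l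
    using that limitin_componentwise[of "\<lambda>_. euclideanreal" UNIV x l sequentially]
    by (simp add: euclidean_product_topology)
  have near: "(\<lambda>k. pt (Suc (\<sigma> k)) (u (\<sigma> k))) \<longlonglongrightarrow> z"
    if u: "\<And>k j. j < n \<Longrightarrow> q k j \<le> u k j \<and> u k j \<le> q k j + 1" for u
  proof (rule limI)
    fix j
    have q_lim: "(\<lambda>k. pt (Suc (\<sigma> k)) (q (\<sigma> k)) j) \<longlonglongrightarrow> z j"
      using coord[OF lim] by (simp add: comp_def)
    show "(\<lambda>k. pt (Suc (\<sigma> k)) (u (\<sigma> k)) j) \<longlonglongrightarrow> z j"
    proof (rule tendsto_sandwich[OF _ _ q_lim])
      show "(\<lambda>k. pt (Suc (\<sigma> k)) (q (\<sigma> k)) j + 1 / real (Suc (\<sigma> k))) \<longlonglongrightarrow> z j"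
        using tendsto_add[OF q_lim inv] by simp
      show "\<forall>\<^sub>F k in sequentially. pt (Suc (\<sigma> k)) (q (\<sigma> k)) j \<le> pt (Suc (\<sigma> k)) (u (\<sigma> k)) j"
        using u by (auto simp: pt_def intro!: always_eventually divide_right_mono)
      have "real (u k j) / real (Suc k) \<le> real (q k j) / real (Suc k) + 1 / real (Suc k)"
        if "j < n" for k
      proof -
        have "real (u k j) \<le> real (q k j) + 1" using u[OF that, of k] by linarith
        then show ?thesis
          by (metis add_divide_distrib divide_right_mono of_nat_0_le_iff)
      qed
      then show "\<forall>\<^sub>F k in sequentially. pt (Suc (\<sigma> k)) (u (\<sigma> k)) j
          \<le> pt (Suc (\<sigma> k)) (q (\<sigma> k)) j + 1 / real (Suc (\<sigma> k))"
        by (auto simp: pt_def intro!: always_eventually)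
    qed
  qed
  have u_cube: "pt (Suc (\<sigma> k)) (u (\<sigma> k)) \<in> unit_cube n"
    if u: "\<And>k j. j < n \<Longrightarrow> q k j \<le> u k j \<and> u k j \<le> q k j + 1" for u k
  proof (rule pt_cube)
    show "\<forall>j<n. u (\<sigma> k) j \<le> Suc (\<sigma> k)"
    proof (intro allI impI)
      fix j assume "j < n"
      then show "u (\<sigma> k) j \<le> Suc (\<sigma> k)" using u[of j "\<sigma> k"] q[of j "\<sigma> k"] by linarith
    qed
  qed simp
  have f_near: "(\<lambda>k. f (pt (Suc (\<sigma> k)) (u (\<sigma> k)))) \<longlonglongrightarrow> f z"
    if u: "\<And>k j. j < n \<Longrightarrow> q k j \<le> u k j \<and> u k j \<le> q k j + 1" for u
    using continuous_on_tendsto_compose[OF cont near[OF u] z] u_cube[OF u] by simp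
  have fixed: "f z i = z i" if i: "i < n" for i
  proof (rule antisym)
    have ri: "\<And>k j. j < n \<Longrightarrow> q k j \<le> r k i j \<and> r k i j \<le> q k j + 1"
      and si: "\<And>k j. j < n \<Longrightarrow> q k j \<le> s k i j \<and> s k i j \<le> q k j + 1"
      using r s i by blast+
    have "pt (Suc k) (r k i) i \<le> f (pt (Suc k) (r k i)) i" for k
      using r0[OF i, of k] by (simp add: label_def split: if_splits)
    then show "z i \<le> f z i"
      by (intro LIMSEQ_le[OF coord[OF near[OF ri]] coord[OF f_near[OF ri]]]) auto
    have "f (pt (Suc (\<sigma> k)) (s (\<sigma> k) i)) i \<le> pt (Suc (\<sigma> k)) (s (\<sigma> k) i) i" for k
    proof (cases "s (\<sigma> k) i i = Suc (\<sigma> k)")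
      case True
      then have "pt (Suc (\<sigma> k)) (s (\<sigma> k) i) i = 1" using i by (simp add: pt_def)
      then show ?thesis using f_range[OF u_cube[OF si] i, of k] by simp
    next
      case False
      then show ?thesis using s1[OF i, of "\<sigma> k"] by (simp add: label_def split: if_splits)
    qed
    then show "f z i \<le> z i"
      by (intro LIMSEQ_le[OF coord[OF f_near[OF si]] coord[OF near[OF si]]]) auto
  qed
  have "f z = z"
  proof
    fix i show "f z i = z i"
      using fixed[of i] z maps by (cases "i < n") (auto simp: unit_cube_def image_subset_iff)
  qed
  with z that show thesis by blast
qed

section \<open>Finite open covers of a simplex\<close>


definition std_simplex :: "nat \<Rightarrow> (nat \<Rightarrow> real) set" where
  "std_simplex n = {x. (\<forall>i<n. 0 \<le> x i) \<and> (\<forall>i\<ge>n. x i = 0) \<and> (\<Sum>i<n. x i) = 1}"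

lemma std_simplex_subset_unit_cube: "std_simplex n \<subseteq> unit_cube n"
proof
  fix x assume x: "x \<in> std_simplex n"
  have "x i \<le> 1" if "i < n" for i
  proof -
    have "x i \<le> (\<Sum>i<n. x i)"
      using x that by (intro member_le_sum) (auto simp: std_simplex_def)
    then show ?thesis using x by (simp add: std_simplex_def)
  qed
  then show "x \<in> unit_cube n" using x by (simp add: std_simplex_def unit_cube_def)
qed

lemma continuous_on_coordinate: "continuous_on S (\<lambda>x::'i \<Rightarrow> real. x i)"
  by (rule continuous_on_subset[OF continuous_on_product_coordinates subset_UNIV])

text \<open>A retraction of the cube onto the simplex: points with coordinate sum below 1 are raised equally in
  all coordinates, those with sum above 1 are scaled
  down. Composition with it turns a self-map of the simplex into one of the cube with the same fixed
  points.\<close>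
definition simplex_retraction :: "nat \<Rightarrow> (nat \<Rightarrow> real) \<Rightarrow> nat \<Rightarrow> real" where
  "simplex_retraction n x =
     (\<lambda>i. if i < n
       then (x i + max 0 (1 - (\<Sum>j<n. x j)) / real n) / max 1 (\<Sum>j<n. x j) else 0)"

lemma continuous_on_simplex_retraction: "continuous_on S (simplex_retraction n)"
proof (rule continuous_on_coordinatewise_then_product)
  fix i
  show "continuous_on S (\<lambda>x. simplex_retraction n x i)"
  proof (cases "i < n")
    case True
    have "\<forall>x\<in>S. max 1 (\<Sum>j<n. x j) \<noteq> 0"
      by (auto simp: max_def)
    moreover have "\<forall>x\<in>S. real n \<noteq> 0" using True by simp
    moreover have sum_cont: "continuous_on S (\<lambda>x. \<Sum>j<n. x j)"
      by (intro continuous_on_sum continuous_on_coordinate)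
    moreover have "continuous_on S (\<lambda>x. max 1 (\<Sum>j<n. x j))"
      by (intro continuous_on_max continuous_on_const sum_cont)
    moreover have "continuous_on S (\<lambda>x. max 0 (1 - (\<Sum>j<n. x j)))"
      by (intro continuous_on_max continuous_on_diff continuous_on_const sum_cont)
    ultimately have "continuous_on S
        (\<lambda>x. (x i + max 0 (1 - (\<Sum>j<n. x j)) / real n) / max 1 (\<Sum>j<n. x j))"
      by (intro continuous_on_divide[OF continuous_on_add[OF continuous_on_coordinate]]
         continuous_on_divide[OF _ continuous_on_const])
    then show ?thesis
      by (simp only: simplex_retraction_def if_P[OF True])
  qed (simp add: simplex_retraction_def)
qed

lemma simplex_retraction_in:
  assumes "0 < n" and "x \<in> unit_cube n"
  shows "simplex_retraction n x \<in> std_simplex n"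
proof -
  let ?\<sigma> = "\<Sum>j<n. x j"
  have "(\<Sum>i<n. simplex_retraction n x i) = (?\<sigma> + max 0 (1 - ?\<sigma>)) / max 1 ?\<sigma>"
    using assms(1) by (simp add: simplex_retraction_def sum_divide_distrib[symmetric] sum.distrib)
  also have "\<dots> = 1" by (simp add: max_def)
  finally show ?thesis
    using assms(2) by (auto simp: std_simplex_def simplex_retraction_def unit_cube_def)
qed

lemma simplex_retraction_id: "x \<in> std_simplex n \<Longrightarrow> simplex_retraction n x = x"
  by (auto simp: std_simplex_def simplex_retraction_def)

text \<open>A dual form of the Knaster--Kuratowski--Mazurkiewicz lemma. Functions \<open>g i\<close> that are positive
  exactly on \<open>U i\<close> have a positive sum on the simplex, and normalizing them gives a continuous
  self-map \<open>h\<close>. At a fixed point of \<open>h\<close> the \<open>i\<close>-th coordinate is a positive multiple of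
  \<open>g i\<close>.\<close>
theorem simplex_open_cover:
  fixes U :: "nat \<Rightarrow> (nat \<Rightarrow> real) set"
  assumes n: "0 < n" and U: "\<And>i. i < n \<Longrightarrow> open (U i)"
    and cover: "std_simplex n \<subseteq> (\<Union>i<n. U i)"
  obtains x where "x \<in> std_simplex n" "\<And>i. i < n \<Longrightarrow> 0 < x i \<Longrightarrow> x \<in> U i"
proof -
  \<comment> \<open>The distance to the empty set is 0 by convention, which would spoil \<open>g i\<close> when \<open>U i\<close> is everything;
     adding a point outside the simplex keeps the closed set nonempty.\<close>
  define A where "A i = insert (\<lambda>_. 2) (- U i)" for i
  define g where "g i x = infdist x (A i)" for i x
  have A: "closed (A i)" "A i \<noteq> {}" if "i < n" for i
    using U[OF that] by (auto simp: A_def intro!: closed_insert)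
  have g_nonneg: "0 \<le> g i x" for i x
    by (simp add: g_def infdist_nonneg)
  have g_pos: "0 < g i x \<longleftrightarrow> x \<in> U i" if "i < n" "x \<in> std_simplex n" for i x
  proof -
    have "x \<noteq> (\<lambda>_. 2)"
      using that(2) by (auto simp: std_simplex_def fun_eq_iff) (metis zero_neq_numeral order_refl)
    then have "x \<in> A i \<longleftrightarrow> x \<notin> U i" by (simp add: A_def)
    then show ?thesis
      using in_closed_iff_infdist_zero[OF A[OF that(1)], of x] g_nonneg[of i x]
      by (auto simp: g_def)
  qed
  have sum_pos: "0 < (\<Sum>i<n. g i x)" if x: "x \<in> std_simplex n" for x
  proof -
    obtain i where "i < n" "x \<in> U i" using cover x by blast
    then show ?thesis
      using g_pos[OF _ x] g_nonneg by (intro sum_pos2[of _ i]) auto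
  qed
  define h where "h x = (\<lambda>i. if i < n then g i x / (\<Sum>j<n. g j x) else 0)" for x
  have h_in: "h x \<in> std_simplex n" if "x \<in> std_simplex n" for x
    using sum_pos[OF that] g_nonneg
    by (auto simp: std_simplex_def h_def sum_divide_distrib[symmetric] intro!: divide_nonneg_nonneg sum_nonneg)
  have h_cont: "continuous_on (std_simplex n) h"
  proof (rule continuous_on_coordinatewise_then_product)
    fix i
    show "continuous_on (std_simplex n) (\<lambda>x. h x i)"
    proof (cases "i < n")
      case True
      have g_cont: "continuous_on (std_simplex n) (g j)" for j
        unfolding g_def by (intro continuous_on_infdist continuous_on_id)
      have "\<forall>x\<in>std_simplex n. (\<Sum>j<n. g j x) \<noteq> 0" using sum_pos by fastforce
      then show ?thesis
        unfolding h_def if_P[OF True]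
        by (intro continuous_on_divide continuous_on_sum g_cont)
    qed (simp add: h_def)
  qed
  let ?r = "simplex_retraction n"
  have r_in: "?r ` unit_cube n \<subseteq> std_simplex n"
    using simplex_retraction_in[OF n] by blast
  have "continuous_on (unit_cube n) (\<lambda>x. h (?r x))"
    by (rule continuous_on_compose2[OF h_cont continuous_on_simplex_retraction r_in])
  moreover have "(\<lambda>x. h (?r x)) ` unit_cube n \<subseteq> unit_cube n"
    using h_in r_in std_simplex_subset_unit_cube by blast
  ultimately obtain x where x: "x \<in> unit_cube n" "h (?r x) = x"
    by (rule Brouwer_unit_cube)
  have xs: "x \<in> std_simplex n"
    using x h_in r_in by (metis image_subset_iff)
  then have fixed: "h x = x" using x(2) by (simp add: simplex_retraction_id)
  have "x \<in> U i" if i: "i < n" "0 < x i" for i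
  proof -
    have "x i = g i x / (\<Sum>j<n. g j x)" using fixed i by (metis h_def)
    then have "g i x \<noteq> 0" using i by auto
    then show ?thesis using g_pos[OF i(1) xs] g_nonneg[of i x] by auto
  qed
  with xs that show thesis by blast
qed

section \<open>Maximal elements on compact convex sets\<close>

text \<open>Read \<open>y \<in> N x\<close> as: \<open>y\<close> is preferred to \<open>x\<close>. If every point of \<open>M\<close> had something preferred to it
  in \<open>M\<close>, then by compactness finitely many alternatives \<open>y i\<close> would do, each on an open set of
  points. Pulling these open sets back to a simplex along \<open>l \<mapsto> \<Sum>i. l i *\<^sub>R y i\<close> gives a point that is a
  convex combination of alternatives preferred to it, hence is preferred to itself. Compactness refers
  to a topology \<open>T\<close> coarser than that of the norm; the norm is only used for the continuity of this
  finite-dimensional map.\<close>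
theorem Browder_Fan_maximal_element:
  fixes M :: "'a::real_normed_vector set" and N :: "'a \<Rightarrow> 'a set"
  assumes coarser: "\<And>U. openin T U \<Longrightarrow> open U"
    and M: "compactin T M" "convex M" "M \<noteq> {}"
    and N_convex: "\<And>x. x \<in> M \<Longrightarrow> convex (N x)"
    and N_irrefl: "\<And>x. x \<in> M \<Longrightarrow> x \<notin> N x"
    and N_open: "\<And>x y. x \<in> M \<Longrightarrow> y \<in> M \<Longrightarrow> y \<in> N x \<Longrightarrow>
        \<exists>U. openin T U \<and> x \<in> U \<and> (\<forall>u\<in>U \<inter> M. y \<in> N u)"
  shows "\<exists>x\<in>M. N x \<inter> M = {}"
proof (rule ccontr)
  assume no_maximal: "\<not> ?thesis"
  have nonempty: "N x \<inter> M \<noteq> {}" if "x \<in> M" for x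
    using that no_maximal by blast
  define P where "P y U \<longleftrightarrow> y \<in> M \<and> openin T U \<and> (\<forall>u\<in>U \<inter> M. y \<in> N u)" for y U
  have "M \<subseteq> \<Union>{U. \<exists>y. P y U}"
  proof
    fix x assume x: "x \<in> M"
    then obtain y where "y \<in> M" "y \<in> N x"
      using nonempty by blast
    then show "x \<in> \<Union>{U. \<exists>y. P y U}"
      using N_open[OF x] unfolding P_def by blast
  qed
  moreover have "\<forall>U\<in>{U. \<exists>y. P y U}. openin T U" by (auto simp: P_def)
  ultimately obtain \<F> where \<F>: "finite \<F>" "\<F> \<subseteq> {U. \<exists>y. P y U}" "M \<subseteq> \<Union>\<F>"
    using M(1) unfolding compactin_def by (metis mem_Collect_eq)
  obtain V n where V: "\<F> = V ` {i::nat. i < n}"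
    using \<F>(1) finite_imp_nat_seg_image_inj_on by metis
  then have "\<forall>i<n. \<exists>y. P y (V i)" using \<F>(2) by blast
  then obtain y where y: "\<And>i. i < n \<Longrightarrow> P (y i) (V i)" by metis
  have "0 < n" using \<F>(3) M(3) V by (cases n) auto
  define c where "c l = (\<Sum>i<n. l i *\<^sub>R y i)" for l
  have c_cont: "continuous_on UNIV c"
    unfolding c_def by (intro continuous_intros continuous_on_coordinate)
  have c_M: "c l \<in> M" if "l \<in> std_simplex n" for l
    unfolding c_def using that y M(2)
    by (intro convex_sum) (auto simp: std_simplex_def P_def)
  have "open (c -` V i)" if "i < n" for i
    using y[OF that] coarser c_cont by (auto simp: P_def intro: open_vimage)
  moreover have "std_simplex n \<subseteq> (\<Union>i<n. c -` V i)"
    using c_M \<F>(3) V by fastforce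
  ultimately obtain l where l: "l \<in> std_simplex n"
    and lV: "\<And>i. i < n \<Longrightarrow> 0 < l i \<Longrightarrow> l \<in> c -` V i"
    using simplex_open_cover[OF \<open>0 < n\<close>, of "\<lambda>i. c -` V i"] by metis
  have l0: "0 \<le> l i" if "i < n" for i using l that by (simp add: std_simplex_def)
  let ?S = "{i. i < n \<and> 0 < l i}"
  have zero: "l i = 0" if "i \<in> {..<n} - ?S" for i using l0[of i] that by auto
  have "(\<Sum>i\<in>?S. l i *\<^sub>R y i) \<in> N (c l)"
  proof (rule convex_sum)
    show "convex (N (c l))" by (rule N_convex[OF c_M[OF l]])
    have "(\<Sum>i\<in>?S. l i) = (\<Sum>i<n. l i)"
      by (rule sum.mono_neutral_left) (use zero in auto)
    then show "(\<Sum>i\<in>?S. l i) = 1" using l by (simp add: std_simplex_def)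
    show "y i \<in> N (c l)" if "i \<in> ?S" for i
      using that lV[of i] y[of i] c_M[OF l] by (auto simp: P_def)
  qed auto
  moreover have "(\<Sum>i\<in>?S. l i *\<^sub>R y i) = c l"
    unfolding c_def by (rule sum.mono_neutral_left) (use zero in auto)
  ultimately show False using N_irrefl[OF c_M[OF l]] by simp
qed

section \<open>Separation by a bounded functional\<close>


definition sublinear :: "('a::real_vector \<Rightarrow> real) \<Rightarrow> bool" where
  "sublinear p \<longleftrightarrow> (\<forall>x y. p (x + y) \<le> p x + p y) \<and> (\<forall>t>0. \<forall>x. p (t *\<^sub>R x) = t * p x)"

lemma sublinear_zero:
  assumes "sublinear p" shows "p 0 = 0"
proof -
  have "p ((2::real) *\<^sub>R 0) = 2 * p 0" using assms unfolding sublinear_def by (meson zero_less_numeral)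
  then show ?thesis by simp
qed

lemma sublinear_lower:
  assumes "sublinear p" shows "- p (- x) \<le> p x"
proof -
  have "p (x + - x) \<le> p x + p (- x)" using assms unfolding sublinear_def by blast
  then show ?thesis using sublinear_zero[OF assms] by simp
qed

text \<open>For each \<open>y\<close> the infimum over \<open>t \<ge> 0\<close> of \<open>q (x + t *\<^sub>R y) - t * q y\<close> is again sublinear in \<open>x\<close> and at
  most \<open>q\<close>, so it is \<open>q\<close> itself. The choice \<open>x = - y\<close>, \<open>t = 1\<close> then gives \<open>q (- y) \<le> - q y\<close>, and an
  odd sublinear function is linear.\<close>
lemma minimal_sublinear_linear:
  assumes q: "sublinear q" and min: "\<And>q'. sublinear q' \<Longrightarrow> q' \<le> q \<Longrightarrow> q' = q"
  shows "linear q"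
proof -
  have add: "q (x + y) \<le> q x + q y" and scale: "0 < t \<Longrightarrow> q (t *\<^sub>R x) = t * q x" for x y t
    using q by (auto simp: sublinear_def)
  have scale0: "0 \<le> t \<Longrightarrow> q (t *\<^sub>R x) = t * q x" for x t
    using scale[of t x] sublinear_zero[OF q] by (cases "t = 0") auto
  have odd: "q (- y) = - q y" for y
  proof -
    define Q where "Q x = (\<lambda>t. q (x + t *\<^sub>R y) - t * q y) ` {0..}" for x
    define q' where "q' x = Inf (Q x)" for x
    have "- q (- x) \<le> v" if v: "v \<in> Q x" for v x
    proof -
      obtain t where t: "0 \<le> t" "v = q (x + t *\<^sub>R y) - t * q y"
        using v unfolding Q_def by blast
      have "q (t *\<^sub>R y) \<le> q (x + t *\<^sub>R y) + q (- x)"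
        using add[of "x + t *\<^sub>R y" "- x"] by simp
      then show ?thesis using t scale0 by simp
    qed
    then have bdd: "bdd_below (Q x)" for x by (meson bdd_belowI)
    have Q_ne: "Q x \<noteq> {}" for x by (auto simp: Q_def)
    have le: "q' x \<le> q (x + t *\<^sub>R y) - t * q y" if "0 \<le> t" for x t
      unfolding q'_def using that by (intro cInf_lower bdd) (auto simp: Q_def)
    have add': "q' (x + z) \<le> q' x + q' z" for x z
    proof -
      have *: "q' (x + z) \<le> a + b" if "a \<in> Q x" "b \<in> Q z" for a b
      proof -
        obtain s t where s: "0 \<le> s" "a = q (x + s *\<^sub>R y) - s * q y"
          and t: "0 \<le> t" "b = q (z + t *\<^sub>R y) - t * q y"
          using \<open>a \<in> Q x\<close> \<open>b \<in> Q z\<close> unfolding Q_def by blast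
        have "x + z + (s + t) *\<^sub>R y = (x + s *\<^sub>R y) + (z + t *\<^sub>R y)" by (simp add: algebra_simps)
        then show ?thesis
          using le[of "s + t" "x + z"] add[of "x + s *\<^sub>R y" "z + t *\<^sub>R y"] s t by (simp add: algebra_simps)
      qed
      have "q' (x + z) - a \<le> q' z" if "a \<in> Q x" for a
        unfolding q'_def[of z] using *[OF that] by (intro cInf_greatest Q_ne) (simp add: algebra_simps)
      then have "q' (x + z) - q' z \<le> q' x"
        unfolding q'_def[of x] by (intro cInf_greatest Q_ne) (simp add: algebra_simps)
      then show ?thesis by simp
    qed
    have scale_le: "q' (t *\<^sub>R x) \<le> t * q' x" if t: "0 < t" for t x
    proof -
      have "q' (t *\<^sub>R x) / t \<le> q' x"
        unfolding q'_def[of x]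
      proof (intro cInf_greatest Q_ne)
        fix v assume "v \<in> Q x"
        then obtain s where s: "0 \<le> s" "v = q (x + s *\<^sub>R y) - s * q y"
          unfolding Q_def by blast
        have "t *\<^sub>R x + (t * s) *\<^sub>R y = t *\<^sub>R (x + s *\<^sub>R y)" by (simp add: algebra_simps)
        then have "q' (t *\<^sub>R x) \<le> t * v"
          using le[of "t * s" "t *\<^sub>R x"] scale[OF t, of "x + s *\<^sub>R y"] s t
          by (simp add: right_diff_distrib mult.assoc)
        then show "q' (t *\<^sub>R x) / t \<le> v" using t by (simp add: field_simps)
      qed
      then show ?thesis using t by (simp add: field_simps)
    qed
    have "q' (t *\<^sub>R x) = t * q' x" if t: "0 < t" for t x
    proof (rule antisym[OF scale_le[OF t]])
      show "t * q' x \<le> q' (t *\<^sub>R x)"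
        using scale_le[of "inverse t" "t *\<^sub>R x"] t by (simp add: field_simps)
    qed
    then have "sublinear q'" using add' by (simp add: sublinear_def)
    moreover have "q' \<le> q" using le[of 0] by (simp add: le_fun_def)
    ultimately have "q' = q" by (rule min)
    then have "q (- y) \<le> - q y" using le[of 1 "- y"] sublinear_zero[OF q] by simp
    then show ?thesis using sublinear_lower[OF q, of y] by simp
  qed
  show ?thesis
  proof (rule linearI)
    fix x y
    show "q (x + y) = q x + q y"
      using add[of x y] add[of "- x" "- y"] odd[of "x + y"] odd[of x] odd[of y] by simp
  next
    fix t :: real and x
    show "q (t *\<^sub>R x) = t *\<^sub>R q x"
      using scale0[of t x] scale0[of "- t" x] odd[of "t *\<^sub>R x"] by (cases "0 \<le> t") auto
  qed
qed

text \<open>The pointwise infimum of a chain of sublinear functions below \<open>p\<close> is finite, because each of them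
  is at least \<open>- p (- x)\<close> at \<open>x\<close>, and it is sublinear. Zorn's lemma therefore gives a minimal sublinear
  function below \<open>p\<close>.\<close>
theorem Hahn_Banach_sublinear:
  assumes p: "sublinear p"
  obtains f where "linear f" "f \<le> p"
proof -
  define A where "A = {q. sublinear q \<and> q \<le> p}"
  have "\<exists>m\<in>A. \<forall>a\<in>A. a \<le> m \<longrightarrow> a = m"
  proof (rule predicate_Zorn)
    show "partial_order_on A (relation_of (\<lambda>a b. b \<le> a) A)"
      by (auto simp: partial_order_on_def preorder_on_def refl_on_def trans_def antisym_def relation_of_def)
    fix \<C> assume "\<C> \<in> Chains (relation_of (\<lambda>a b. b \<le> a) A)"
    then have \<C>A: "\<C> \<subseteq> A" and total: "\<And>a b. a \<in> \<C> \<Longrightarrow> b \<in> \<C> \<Longrightarrow> a \<le> b \<or> b \<le> a"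
      by (auto simp: Chains_def relation_of_def)
    show "\<exists>u\<in>A. \<forall>a\<in>\<C>. u \<le> a"
    proof (cases "\<C> = {}")
      case True then show ?thesis using p by (auto simp: A_def)
    next
      case ne: False
      define u where "u x = (INF q\<in>\<C>. q x)" for x
      have subl: "sublinear q" and below: "q x \<le> p x" if "q \<in> \<C>" for q x
        using that \<C>A by (auto simp: A_def le_fun_def)
      have "- p (- x) \<le> q x" if "q \<in> \<C>" for q x
        using sublinear_lower[OF subl[OF that], of x] below[OF that, of "- x"] by simp
      then have bdd: "bdd_below ((\<lambda>q. q x) ` \<C>)" for x by (meson bdd_belowI2)
      have u_le: "u x \<le> q x" if "q \<in> \<C>" for q x
        unfolding u_def using that bdd by (intro cINF_lower)
      \<comment> \<open>Comparability of \<open>a\<close> and \<open>b\<close> is what makes the infimum subadditive: the smaller one serves for both.\<close>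
      have "u (x + y) \<le> u x + u y" for x y
      proof -
        have *: "u (x + y) \<le> a x + b y" if ab: "a \<in> \<C>" "b \<in> \<C>" for a b
        proof -
          obtain c where c: "c \<in> \<C>" "c \<le> a" "c \<le> b" using total[OF ab] ab by blast
          have "u (x + y) \<le> c x + c y"
            using u_le[OF c(1), of "x + y"] subl[OF c(1)] unfolding sublinear_def by (meson order_trans)
          then show ?thesis using c by (meson le_funD add_mono order_trans)
        qed
        have "u (x + y) - a x \<le> u y" if "a \<in> \<C>" for a
          unfolding u_def[of y] using *[OF that] by (intro cINF_greatest ne) (simp add: algebra_simps)
        then have "u (x + y) - u y \<le> u x"
          unfolding u_def[of x] by (intro cINF_greatest ne) (simp add: algebra_simps)
        then show ?thesis by simp
      qed
      moreover have scale_le: "u (t *\<^sub>R x) \<le> t * u x" if t: "0 < t" for t x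
      proof -
        have "u (t *\<^sub>R x) / t \<le> u x"
          unfolding u_def[of x]
        proof (intro cINF_greatest ne)
          fix q assume "q \<in> \<C>"
          then have "u (t *\<^sub>R x) \<le> t * q x"
            using u_le[of q "t *\<^sub>R x"] subl[of q] t by (simp add: sublinear_def)
          then show "u (t *\<^sub>R x) / t \<le> q x" using t by (simp add: field_simps)
        qed
        then show ?thesis using t by (simp add: field_simps)
      qed
      moreover have "t * u x \<le> u (t *\<^sub>R x)" if t: "0 < t" for t x
        using scale_le[of "inverse t" "t *\<^sub>R x"] t by (simp add: field_simps)
      ultimately have "sublinear u" unfolding sublinear_def by (meson antisym)
      moreover have "u \<le> p" using ne u_le below by (metis le_funI order_trans ex_in_conv)
      ultimately show ?thesis using u_le by (auto simp: A_def le_fun_def)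
    qed
  qed
  then obtain m where m: "m \<in> A" "\<And>a. a \<in> A \<Longrightarrow> a \<le> m \<Longrightarrow> a = m" by blast
  have "linear m"
  proof (rule minimal_sublinear_linear)
    show "sublinear m" using m(1) by (simp add: A_def)
    show "q' = m" if "sublinear q'" "q' \<le> m" for q'
      using m that by (auto simp: A_def)
  qed
  then show thesis using m(1) that by (auto simp: A_def)
qed

text \<open>Let \<open>d\<close> be the distance from \<open>x\<close> to \<open>K\<close>. The infimum \<open>p v\<close> of \<open>norm (v + t *\<^sub>R (k - x)) - t * d\<close> over
  \<open>t \<ge> 0\<close> and \<open>k \<in> K\<close> is the largest sublinear function that is at most the norm everywhere and at
  most \<open>- d\<close> at every \<open>x - k\<close>. A linear functional below it is bounded by the first bound and
  separates by the second.\<close>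
theorem Hahn_Banach_separation:
  fixes K :: "'a::real_normed_vector set"
  assumes K: "convex K" "closed K" "K \<noteq> {}" and x: "x \<notin> K"
  obtains f :: "'a \<Rightarrow>\<^sub>L real" and d where "0 < d" "\<And>k. k \<in> K \<Longrightarrow> f x + d \<le> f k"
proof -
  define d where "d = infdist x K"
  have d: "0 < d" unfolding d_def by (rule infdist_pos_not_in_closed[OF K(2,3) x])
  have dist: "d \<le> norm (k - x)" if "k \<in> K" for k
    using infdist_le[OF that, of x] by (simp add: d_def dist_norm norm_minus_commute)
  define Q where "Q v = {norm (v + t *\<^sub>R (k - x)) - t * d | t k. 0 \<le> t \<and> k \<in> K}" for v
  define p where "p v = Inf (Q v)" for v
  have "- norm v \<le> a" if a: "a \<in> Q v" for a v
  proof -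
    obtain t k where tk: "0 \<le> t" "k \<in> K" "a = norm (v + t *\<^sub>R (k - x)) - t * d"
      using a unfolding Q_def by blast
    have "t * d \<le> norm (t *\<^sub>R (k - x))" using dist[OF tk(2)] tk(1) by (simp add: mult_left_mono)
    also have "\<dots> \<le> norm (v + t *\<^sub>R (k - x)) + norm v"
      using norm_triangle_ineq4[of "v + t *\<^sub>R (k - x)" v] by simp
    finally show ?thesis using tk(3) by simp
  qed
  then have bdd: "bdd_below (Q v)" for v by (meson bdd_belowI)
  have Q_ne: "Q v \<noteq> {}" for v using K(3) by (auto simp: Q_def)
  have le: "p v \<le> norm (v + t *\<^sub>R (k - x)) - t * d" if "0 \<le> t" "k \<in> K" for v t k
    unfolding p_def using that by (intro cInf_lower bdd) (auto simp: Q_def)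
  have add: "p (v + w) \<le> p v + p w" for v w
  proof -
    have *: "p (v + w) \<le> a + b" if "a \<in> Q v" "b \<in> Q w" for a b
    proof -
      obtain s k where s: "0 \<le> s" "k \<in> K" "a = norm (v + s *\<^sub>R (k - x)) - s * d"
        using \<open>a \<in> Q v\<close> unfolding Q_def by blast
      obtain t l where t: "0 \<le> t" "l \<in> K" "b = norm (w + t *\<^sub>R (l - x)) - t * d"
        using \<open>b \<in> Q w\<close> unfolding Q_def by blast
      \<comment> \<open>Convexity of \<open>K\<close> merges the two multiples of differences into a single one.\<close>
      obtain m where m: "m \<in> K" "(s + t) *\<^sub>R (m - x) = s *\<^sub>R (k - x) + t *\<^sub>R (l - x)"
      proof (cases "s + t = 0")
        case True
        then have "s = 0" "t = 0" using s(1) t(1) by auto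
        then show thesis using that[OF s(2)] by simp
      next
        case False
        let ?m = "(s / (s + t)) *\<^sub>R k + (t / (s + t)) *\<^sub>R l"
        have "?m \<in> K"
          using s t False by (intro convexD[OF K(1)]) (auto simp: add_divide_distrib[symmetric])
        moreover have "(s + t) *\<^sub>R (?m - x) = s *\<^sub>R (k - x) + t *\<^sub>R (l - x)"
        proof -
          have "(s + t) *\<^sub>R ?m = s *\<^sub>R k + t *\<^sub>R l" using False by (simp add: scaleR_add_right)
          then show ?thesis by (simp add: scaleR_diff_right scaleR_add_left)
        qed
        ultimately show thesis by (rule that)
      qed
      have "p (v + w) \<le> norm ((v + s *\<^sub>R (k - x)) + (w + t *\<^sub>R (l - x))) - (s + t) * d"
        using le[of "s + t" m "v + w"] m s(1) t(1) by (simp add: algebra_simps)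
      also have "\<dots> \<le> a + b"
        using norm_triangle_ineq[of "v + s *\<^sub>R (k - x)" "w + t *\<^sub>R (l - x)"] s(3) t(3)
        by (simp add: algebra_simps)
      finally show ?thesis .
    qed
    have "p (v + w) - a \<le> p w" if "a \<in> Q v" for a
      unfolding p_def[of w] using *[OF that] by (intro cInf_greatest Q_ne) (simp add: algebra_simps)
    then have "p (v + w) - p w \<le> p v"
      unfolding p_def[of v] by (intro cInf_greatest Q_ne) (simp add: algebra_simps)
    then show ?thesis by simp
  qed
  have scale_le: "p (t *\<^sub>R v) \<le> t * p v" if t: "0 < t" for t v
  proof -
    have "p (t *\<^sub>R v) / t \<le> p v"
      unfolding p_def[of v]
    proof (intro cInf_greatest Q_ne)
      fix a assume "a \<in> Q v"
      then obtain s k where s: "0 \<le> s" "k \<in> K" "a = norm (v + s *\<^sub>R (k - x)) - s * d"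
        unfolding Q_def by blast
      have eq: "t *\<^sub>R v + (t * s) *\<^sub>R (k - x) = t *\<^sub>R (v + s *\<^sub>R (k - x))"
        by (simp add: algebra_simps)
      have "p (t *\<^sub>R v) \<le> norm (t *\<^sub>R (v + s *\<^sub>R (k - x))) - (t * s) * d"
        using le[of "t * s" k "t *\<^sub>R v"] s t unfolding eq by simp
      also have "\<dots> = t * a" using s(3) t by (simp add: right_diff_distrib)
      finally show "p (t *\<^sub>R v) / t \<le> a" using t by (simp add: field_simps)
    qed
    then show ?thesis using t by (simp add: field_simps)
  qed
  have "t * p v \<le> p (t *\<^sub>R v)" if t: "0 < t" for t v
    using scale_le[of "inverse t" "t *\<^sub>R v"] t by (simp add: field_simps)
  then have "sublinear p" unfolding sublinear_def using add scale_le by (meson antisym)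
  then obtain f where f: "linear f" "f \<le> p" by (rule Hahn_Banach_sublinear)
  obtain k0 where "k0 \<in> K" using K(3) by blast
  then have f_le: "f v \<le> norm v" for v
    using le[of 0 k0 v] le_funD[OF f(2), of v] by simp
  have "norm (f v) \<le> norm v * 1" for v
    using f_le[of v] f_le[of "- v"] linear_neg[OF f(1), of v] by (simp add: abs_le_iff)
  then have blin: "bounded_linear f"
    using f(1) by (intro bounded_linear_intro[of f 1]) (auto simp: linear_add linear_scale)
  show thesis
  proof (rule that[of d "Blinfun f"])
    show "0 < d" by (rule d)
    fix k assume k: "k \<in> K"
    have "f (x - k) \<le> - d"
      using le[of 1 k "x - k"] le_funD[OF f(2), of "x - k"] k by simp
    then show "blinfun_apply (Blinfun f) x + d \<le> blinfun_apply (Blinfun f) k"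
      using linear_diff[OF f(1), of x k] by (simp add: bounded_linear_Blinfun_apply[OF blin])
  qed
qed

section \<open>Weak compactness in reflexive spaces\<close>


lemma topspace_weak_topology [simp]: "topspace weak_topology = (UNIV :: 'a::real_normed_vector set)"
proof -
  have "(UNIV :: 'a set) \<in> {blinfun_apply f -` U | (f :: 'a \<Rightarrow>\<^sub>L real) U. open U}"
    by (rule CollectI, rule exI[of _ 0], rule exI[of _ UNIV]) simp
  then show ?thesis
    unfolding weak_topology_def topology_generated_by_topspace by blast
qed

lemma openin_weak_imp_open:
  fixes U :: "'a::real_normed_vector set"
  assumes "openin weak_topology U"
  shows "open U"
proof -
  have "continuous_map (euclidean :: 'a topology) weak_topology (\<lambda>x. x)"
    unfolding weak_topology_def
  proof (rule continuous_on_generated_topo)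
    fix V :: "'a set" assume "V \<in> {blinfun_apply f -` U | (f :: 'a \<Rightarrow>\<^sub>L real) U. open U}"
    then obtain f :: "'a \<Rightarrow>\<^sub>L real" and W where "V = blinfun_apply f -` W" "open W" by blast
    then show "openin euclidean ((\<lambda>x. x) -` V \<inter> topspace euclidean)"
      by (simp add: open_vimage blinfun.continuous_on continuous_on_id)
  next
    show "(\<lambda>x. x) ` topspace euclidean \<subseteq> \<Union> {blinfun_apply f -` U | (f :: 'a \<Rightarrow>\<^sub>L real) U. open U}"
      using topspace_weak_topology[where 'a = 'a]
      unfolding weak_topology_def topology_generated_by_topspace by simp
  qed
  from openin_continuous_map_preimage[OF this assms] show ?thesis by simp
qed

text \<open>Evaluation embeds the space, with its weak topology, into the product of copies of the reals indexed
  by the dual, and the image of \<open>K\<close> lies in a product of compact intervals. It is closed there: a point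
  \<open>\<phi>\<close> of its closure is a bounded linear functional on the dual, hence evaluation at some \<open>x\<close> by
  reflexivity, and \<open>x \<in> K\<close> because a functional that separates \<open>x\<close> from \<open>K\<close> would also keep \<open>\<phi>\<close> away
  from the image of \<open>K\<close>. So the image is compact, and the inverse of the embedding, which is
  continuous into the weak topology, carries compactness back to \<open>K\<close>.\<close>
theorem reflexive_weakly_compact:
  fixes K :: "'a::real_normed_vector set"
  assumes refl: "reflexive_space TYPE('a)" and K: "convex K" "closed K" "bounded K"
  shows "compactin weak_topology K"
proof (cases "K = {}")
  case False
  define J :: "'a \<Rightarrow> ('a \<Rightarrow>\<^sub>L real) \<Rightarrow> real" where "J x f = f x" for x f
  obtain r where r: "\<And>x. x \<in> K \<Longrightarrow> norm x \<le> r" using K(3) unfolding bounded_iff by blast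
  let ?B = "Pi\<^sub>E UNIV (\<lambda>f::'a \<Rightarrow>\<^sub>L real. {- (norm f * r)..norm f * r})"
  have J_bound: "\<bar>f x\<bar> \<le> norm f * r" if "x \<in> K" for x and f :: "'a \<Rightarrow>\<^sub>L real"
    using norm_blinfun[of f x] mult_left_mono[OF r[OF that] norm_ge_zero[of f]] by simp
  have J_B: "J ` K \<subseteq> ?B"
    using J_bound by (auto simp: J_def abs_le_iff minus_le_iff)
  have "compactin (product_topology (\<lambda>_. euclidean) UNIV) ?B"
    by (subst compactin_PiE) auto
  then have B: "compact ?B" by (simp add: euclidean_product_topology)
  have ev: "continuous_on UNIV (\<lambda>\<phi>::('a \<Rightarrow>\<^sub>L real) \<Rightarrow> real. \<phi> f)" for f
    by (rule continuous_on_product_coordinates)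
  have "closure (J ` K) \<subseteq> J ` K"
  proof
    fix \<phi> assume \<phi>: "\<phi> \<in> closure (J ` K)"
    have in_closed: "\<phi> \<in> S" if "closed S" "J ` K \<subseteq> S" for S
      using \<phi> that closure_minimal by blast
    have add: "\<phi> (f + g) = \<phi> f + \<phi> g" for f g
    proof -
      have cl: "closed {\<psi>::('a \<Rightarrow>\<^sub>L real) \<Rightarrow> real. \<psi> (f + g) = \<psi> f + \<psi> g}"
        by (intro closed_Collect_eq continuous_on_add ev)
      have sub: "J ` K \<subseteq> {\<psi>. \<psi> (f + g) = \<psi> f + \<psi> g}"
        by (simp add: J_def plus_blinfun.rep_eq image_subset_iff)
      show ?thesis using in_closed[OF cl sub] by simp
    qed
    have scale: "\<phi> (t *\<^sub>R f) = t * \<phi> f" for t f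
    proof -
      have cl: "closed {\<psi>::('a \<Rightarrow>\<^sub>L real) \<Rightarrow> real. \<psi> (t *\<^sub>R f) = t * \<psi> f}"
        by (intro closed_Collect_eq continuous_on_mult continuous_on_const ev)
      have sub: "J ` K \<subseteq> {\<psi>. \<psi> (t *\<^sub>R f) = t * \<psi> f}"
        by (simp add: J_def scaleR_blinfun.rep_eq image_subset_iff)
      show ?thesis using in_closed[OF cl sub] by simp
    qed
    have bound: "\<bar>\<phi> f\<bar> \<le> norm f * r" for f
    proof -
      have cl: "closed {\<psi>::('a \<Rightarrow>\<^sub>L real) \<Rightarrow> real. \<bar>\<psi> f\<bar> \<le> norm f * r}"
        by (intro closed_Collect_le continuous_on_const continuous_on_rabs ev)
      have sub: "J ` K \<subseteq> {\<psi>. \<bar>\<psi> f\<bar> \<le> norm f * r}"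
        using J_bound by (simp add: J_def image_subset_iff)
      show ?thesis using in_closed[OF cl sub] by simp
    qed
    have "bounded_linear \<phi>"
      by (rule bounded_linear_intro[of _ r]) (use add scale bound in auto)
    then have \<phi>_blin: "blinfun_apply (Blinfun \<phi>) = \<phi>" by (rule bounded_linear_Blinfun_apply)
    obtain x where "\<forall>f. blinfun_apply (Blinfun \<phi>) f = blinfun_apply f x"
      using refl unfolding reflexive_space_def by blast
    then have x: "\<phi> f = f x" for f by (simp add: \<phi>_blin)
    have "x \<in> K"
    proof (rule ccontr)
      assume "x \<notin> K"
      then obtain f :: "'a \<Rightarrow>\<^sub>L real" and d where f: "0 < d" "\<And>k. k \<in> K \<Longrightarrow> f x + d \<le> f k"
        using Hahn_Banach_separation[OF K(1,2) False] by metis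
      have cl: "closed {\<psi>::('a \<Rightarrow>\<^sub>L real) \<Rightarrow> real. f x + d \<le> \<psi> f}"
        by (intro closed_Collect_le continuous_on_const ev)
      have sub: "J ` K \<subseteq> {\<psi>. f x + d \<le> \<psi> f}" using f(2) by (auto simp: J_def)
      have "f x + d \<le> \<phi> f" using in_closed[OF cl sub] by simp
      then show False using x f(1) by simp
    qed
    moreover have "\<phi> = J x" by (simp add: fun_eq_iff x J_def)
    ultimately show "\<phi> \<in> J ` K" by blast
  qed
  then have "closed (J ` K)" by (metis closure_subset closure_eq subset_antisym)
  then have "compact (J ` K)"
    using compact_Int_closed[OF B] J_B by (metis Int_absorb1)
  then have cpt: "compactin (top_of_set (J ` K)) (J ` K)" by (simp add: compactin_subtopology)
  have J_inj: "inj_on J K"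
  proof (rule inj_onI, rule ccontr)
    fix x y assume "J x = J y" "x \<noteq> y"
    then have y: "convex {y}" "closed {y}" "{y} \<noteq> {}" "x \<notin> {y}" by auto
    obtain f :: "'a \<Rightarrow>\<^sub>L real" and d where "0 < d" "f x + d \<le> f y"
      using Hahn_Banach_separation[OF y] by (metis singletonI)
    then show False using \<open>J x = J y\<close> by (simp add: J_def fun_eq_iff)
  qed
  have "continuous_map (top_of_set (J ` K)) weak_topology (inv_into K J)"
    unfolding weak_topology_def
  proof (rule continuous_on_generated_topo)
    fix V :: "'a set" assume "V \<in> {blinfun_apply f -` U | (f :: 'a \<Rightarrow>\<^sub>L real) U. open U}"
    then obtain f :: "'a \<Rightarrow>\<^sub>L real" and W where V: "V = blinfun_apply f -` W" "open W" by blast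
    have "f (inv_into K J \<phi>) = \<phi> f" if "\<phi> \<in> J ` K" for \<phi>
      using f_inv_into_f[OF that] by (simp add: J_def fun_eq_iff)
    then have "inv_into K J -` V \<inter> topspace (top_of_set (J ` K)) = J ` K \<inter> (\<lambda>\<phi>. \<phi> f) -` W"
      using V(1) by auto
    moreover have "open ((\<lambda>\<phi>::('a \<Rightarrow>\<^sub>L real) \<Rightarrow> real. \<phi> f) -` W)"
      by (rule open_vimage[OF V(2) ev])
    ultimately show "openin (top_of_set (J ` K)) (inv_into K J -` V \<inter> topspace (top_of_set (J ` K)))"
      by (simp add: openin_open_Int)
  next
    show "inv_into K J ` topspace (top_of_set (J ` K)) \<subseteq> \<Union> {blinfun_apply f -` U | (f :: 'a \<Rightarrow>\<^sub>L real) U. open U}"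
      using topspace_weak_topology[where 'a = 'a]
      unfolding weak_topology_def topology_generated_by_topspace by simp
  qed
  from image_compactin[OF cpt this] show ?thesis
    by (simp add: inv_into_image_cancel[OF J_inj])
qed simp

section \<open>Cones with interior in topological vector spaces\<close>


lemma continuous_on_scaleR_left:
  "continuous_on S (\<lambda>x::'z::topological_real_vector. t *\<^sub>R x)"
  unfolding continuous_on_def
proof
  fix z :: 'z
  have "LIM x nhds z. (t, x) :> nhds t \<times>\<^sub>F nhds z"
    by (intro filterlim_Pair filterlim_ident tendsto_const)
  from filterlim_compose[OF tendsto_scaleR_Pair this]
  have "((\<lambda>x. t *\<^sub>R x) \<longlongrightarrow> t *\<^sub>R z) (nhds z)" by simp
  then show "((\<lambda>x. t *\<^sub>R x) \<longlongrightarrow> t *\<^sub>R z) (at z within S)"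
    by (rule tendsto_mono[rotated]) (simp add: at_within_def)
qed

text \<open>Translation by \<open>c\<close> carries the interior of \<open>C\<close> to an open set, and this set is contained in
  \<open>C\<close>.\<close>
lemma interior_cone_add:
  fixes C :: "'z::topological_ab_group_add set"
  assumes C: "\<And>c d. c \<in> C \<Longrightarrow> d \<in> C \<Longrightarrow> c + d \<in> C"
    and x: "x \<in> interior C" and c: "c \<in> C"
  shows "x + c \<in> interior C"
proof -
  have "open ((\<lambda>z. z - c) -` interior C)"
    by (intro open_vimage open_interior continuous_on_diff continuous_on_id continuous_on_const)
  moreover have "(\<lambda>z. z - c) -` interior C \<subseteq> C"
  proof
    fix z assume "z \<in> (\<lambda>z. z - c) -` interior C"
    then have "(z - c) + c \<in> C" using C c interior_subset by blast
    then show "z \<in> C" by simp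
  qed
  ultimately have "(\<lambda>z. z - c) -` interior C \<subseteq> interior C" by (rule interior_maximal[rotated])
  moreover have "x + c \<in> (\<lambda>z. z - c) -` interior C" using x by simp
  ultimately show ?thesis by blast
qed

lemma interior_cone_scaleR:
  fixes C :: "'z::topological_real_vector set"
  assumes C: "cone C" and x: "x \<in> interior C" and t: "0 < t"
  shows "t *\<^sub>R x \<in> interior C"
proof -
  have "open ((\<lambda>z. inverse t *\<^sub>R z) -` interior C)"
    by (intro open_vimage open_interior continuous_on_scaleR_left)
  moreover have "(\<lambda>z. inverse t *\<^sub>R z) -` interior C \<subseteq> C"
  proof
    fix z assume "z \<in> (\<lambda>z. inverse t *\<^sub>R z) -` interior C"
    then have "inverse t *\<^sub>R z \<in> C" using interior_subset by blast
    then have "t *\<^sub>R (inverse t *\<^sub>R z) \<in> C" using C t unfolding cone_def by (meson less_imp_le)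
    then show "z \<in> C" using t by simp
  qed
  ultimately have "(\<lambda>z. inverse t *\<^sub>R z) -` interior C \<subseteq> interior C"
    by (rule interior_maximal[rotated])
  moreover have "t *\<^sub>R x \<in> (\<lambda>z. inverse t *\<^sub>R z) -` interior C" using x t by simp
  ultimately show ?thesis by blast
qed

lemma pointed_convex_coneD:
  assumes "pointed_convex_cone C"
  shows "cone C" "\<And>c d. c \<in> C \<Longrightarrow> d \<in> C \<Longrightarrow> c + d \<in> C"
  using assms unfolding pointed_convex_cone_def by blast+

lemma mem_uminus_image_iff: "x \<in> uminus ` A \<longleftrightarrow> - x \<in> A" for x :: "'z::group_add"
  by (metis image_iff minus_minus)

lemma neg_interior_diff:
  fixes C :: "'z::topological_real_vector set"
  assumes "pointed_convex_cone C" "x \<in> uminus ` interior C" "c \<in> C"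
  shows "x - c \<in> uminus ` interior C"
  using interior_cone_add[OF pointed_convex_coneD(2)[OF assms(1)], of "- x" c] assms(2,3)
  by (simp add: mem_uminus_image_iff add.commute)

lemma neg_interior_scaleR:
  fixes C :: "'z::topological_real_vector set"
  assumes "pointed_convex_cone C" "x \<in> uminus ` interior C" "0 < t"
  shows "t *\<^sub>R x \<in> uminus ` interior C"
  using interior_cone_scaleR[OF pointed_convex_coneD(1)[OF assms(1)], of "- x" t] assms(2,3)
  by (simp add: mem_uminus_image_iff)

lemma open_neg_interior:
  fixes C :: "'z::topological_real_vector set"
  shows "open (uminus ` interior C)"
proof -
  have "uminus ` interior C = uminus -` interior C"
    using mem_uminus_image_iff by blast
  then show ?thesis
    by (simp add: open_vimage continuous_on_minus)
qed

text \<open>Strict negativity at \<open>x\<close> and weak negativity at \<open>y\<close> are enough as long as \<open>x\<close> has positive weight.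
  With \<open>y\<close> strictly negative this makes strict sublevel sets convex; with \<open>y\<close> only weakly negative it
  carries strict negativity from a far point into the ball of the coercivity condition.\<close>
lemma C_convex_combination_neg_interior:
  fixes C :: "'z::topological_real_vector set"
  assumes C: "pointed_convex_cone C" and g: "C_convex_on C K g"
    and xy: "x \<in> K" "y \<in> K" and gx: "g x \<in> uminus ` interior C" and gy: "g y \<in> uminus ` C"
    and t: "0 < t" "t \<le> 1"
  shows "g (t *\<^sub>R x + (1 - t) *\<^sub>R y) \<in> uminus ` interior C"
proof -
  define c where "c = t *\<^sub>R g x + (1 - t) *\<^sub>R g y - g (t *\<^sub>R x + (1 - t) *\<^sub>R y)"
  have "c \<in> C" using g xy t unfolding C_convex_on_def c_def by simp
  moreover have "(1 - t) *\<^sub>R (- g y) \<in> C"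
    using pointed_convex_coneD(1)[OF C] gy t unfolding cone_def mem_uminus_image_iff
    by (simp del: scaleR_minus_right)
  ultimately have "(1 - t) *\<^sub>R (- g y) + c \<in> C" by (rule pointed_convex_coneD(2)[OF C, rotated])
  from neg_interior_diff[OF C neg_interior_scaleR[OF C gx t(1)] this]
  show ?thesis by (simp add: c_def)
qed

lemma convex_neg_interior_sublevel:
  fixes C :: "'z::topological_real_vector set"
  assumes C: "pointed_convex_cone C" and K: "convex K" and g: "C_convex_on C K g"
  shows "convex {y \<in> K. g y \<in> uminus ` interior C}"
  unfolding convex_alt
proof (intro ballI allI impI)
  fix x y and u :: real
  assume x: "x \<in> {y \<in> K. g y \<in> uminus ` interior C}" and y: "y \<in> {y \<in> K. g y \<in> uminus ` interior C}"
    and u: "0 \<le> u \<and> u \<le> 1"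
  have "g ((1 - u) *\<^sub>R x + u *\<^sub>R y) \<in> uminus ` interior C"
  proof (cases "u = 1")
    case False
    have "g y \<in> uminus ` C" using y interior_subset by blast
    then show ?thesis
      using C_convex_combination_neg_interior[OF C g, of x y "1 - u"] x y u False by simp
  qed (use y in simp)
  moreover have "(1 - u) *\<^sub>R x + u *\<^sub>R y \<in> K" using K x y u by (simp add: convex_alt)
  ultimately show "(1 - u) *\<^sub>R x + u *\<^sub>R y \<in> {y \<in> K. g y \<in> uminus ` interior C}" by simp
qed

section \<open>From nets and semicontinuity to open sets of strict negativity\<close>

text \<open>If no neighborhood worked, choosing in each neighborhood \<open>U\<close> of \<open>l\<close> the offending points \<open>p\<close> gives a
  net of pairs \<open>(p, U)\<close>, ordered by shrinking \<open>U\<close>, that converges to \<open>l\<close> and contradicts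
  closedness.\<close>
lemma net_closed_imp_nbhd:
  fixes C :: "'z::topological_real_vector set" and l :: 'a
  assumes g: "net_closed TYPE('a \<times> 'a set) T C K g"
    and l: "l \<in> K" "l \<in> topspace T" "g l \<in> uminus ` interior C"
  shows "\<exists>U. openin T U \<and> l \<in> U \<and> (\<forall>u\<in>U \<inter> K. g u \<in> uminus ` interior C)"
proof (rule ccontr)
  assume none: "\<not> ?thesis"
  define D where "D = {(p, U). openin T U \<and> l \<in> U \<and> p \<in> U \<inter> K \<and> g p \<notin> uminus ` interior C}"
  define le where "le a b \<longleftrightarrow> snd b \<subseteq> snd a" for a b :: "'a \<times> 'a set"
  have D_ex: "\<exists>p. (p, U) \<in> D" if "openin T U" "l \<in> U" for U
    using none that unfolding D_def by blast
  have dir: "directed_set D le"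
    unfolding directed_set_def
  proof (intro conjI ballI)
    show "D \<noteq> {}" using D_ex[OF openin_topspace l(2)] by blast
    show "reflp_on D le" "transp_on D le" by (auto simp: reflp_on_def transp_on_def le_def)
    fix a b assume "a \<in> D" "b \<in> D"
    then have "openin T (snd a \<inter> snd b)" "l \<in> snd a \<inter> snd b" by (auto simp: D_def)
    then obtain p where "(p, snd a \<inter> snd b) \<in> D" using D_ex by blast
    then show "\<exists>c\<in>D. le a c \<and> le b c" by (intro bexI[of _ "(p, snd a \<inter> snd b)"]) (auto simp: le_def)
  qed
  have "limitin T fst l (net_filter D le)"
    unfolding limitin_def eventually_net_filter[OF dir]
  proof (intro conjI allI impI)
    fix U assume "openin T U \<and> l \<in> U"
    then obtain p where "(p, U) \<in> D" using D_ex by blast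
    then show "\<exists>\<alpha>\<in>D. \<forall>\<beta>\<in>D. le \<alpha> \<beta> \<longrightarrow> fst \<beta> \<in> U"
      by (intro bexI[of _ "(p, U)"]) (auto simp: le_def D_def)
  qed (rule l(2))
  moreover have "\<forall>\<alpha>\<in>D. fst \<alpha> \<in> K" "\<forall>\<alpha>\<in>D. g (fst \<alpha>) \<notin> uminus ` interior C"
    by (auto simp: D_def)
  ultimately have "g l \<notin> uminus ` interior C"
    using g l(1) dir unfolding net_closed_def by blast
  with l(3) show False by simp
qed

text \<open>If \<open>g l\<close> were strictly negative, so would be the smaller value \<open>z0\<close>, hence eventually \<open>z \<alpha>\<close>, hence
  the still smaller \<open>g (x \<alpha>)\<close>.\<close>
lemma net_C_bounded_imp_net_closed:
  fixes C :: "'z::topological_real_vector set"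
  assumes C: "pointed_convex_cone C" and g: "net_C_bounded TYPE('i) T C K g"
  shows "net_closed TYPE('i) T C K g"
  unfolding net_closed_def
proof (intro allI ballI impI notI)
  fix D :: "'i set" and le x l
  assume l: "l \<in> K" "g l \<in> uminus ` interior C"
    and net: "directed_set D le \<and> (\<forall>\<alpha>\<in>D. x \<alpha> \<in> K) \<and> limitin T x l (net_filter D le) \<and>
      (\<forall>\<alpha>\<in>D. g (x \<alpha>) \<notin> uminus ` interior C)"
  then have dir: "directed_set D le" by blast
  obtain z z0 where z: "(z \<longlongrightarrow> z0) (net_filter D le)"
      and gz: "\<forall>\<alpha>\<in>D. g (x \<alpha>) - z \<alpha> \<in> uminus ` C" and gl: "g l - z0 \<in> C"
    using g l(1) net unfolding net_C_bounded_def by blast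
  have "z0 \<in> uminus ` interior C"
    using neg_interior_diff[OF C l(2) gl] by simp
  then have "\<forall>\<^sub>F \<alpha> in net_filter D le. z \<alpha> \<in> uminus ` interior C"
    using z open_neg_interior topological_tendstoD by blast
  then obtain \<alpha> where \<alpha>: "\<alpha> \<in> D" "\<forall>\<beta>\<in>D. le \<alpha> \<beta> \<longrightarrow> z \<beta> \<in> uminus ` interior C"
    unfolding eventually_net_filter[OF dir] by blast
  moreover have "le \<alpha> \<alpha>" using dir \<alpha>(1) by (auto simp: directed_set_def reflp_on_def)
  ultimately have "z \<alpha> \<in> uminus ` interior C" by blast
  moreover have "z \<alpha> - g (x \<alpha>) \<in> C" using gz \<alpha>(1) by (simp add: mem_uminus_image_iff)
  ultimately have "z \<alpha> - (z \<alpha> - g (x \<alpha>)) \<in> uminus ` interior C" by (rule neg_interior_diff[OF C])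
  then show False using net \<alpha>(1) by simp
qed

lemma C_usc_on_imp_nbhd:
  fixes C :: "'z::topological_real_vector set"
  assumes C: "pointed_convex_cone C" and g: "C_usc_on T C K g"
    and l: "l \<in> K" "g l \<in> uminus ` interior C"
  shows "\<exists>U. openin T U \<and> l \<in> U \<and> (\<forall>u\<in>U \<inter> K. g u \<in> uminus ` interior C)"
proof -
  obtain U where U: "openin T U" "l \<in> U"
      "\<forall>u\<in>U \<inter> K. g u \<in> {v - c | v c. v \<in> uminus ` interior C \<and> c \<in> C}"
    using g l open_neg_interior unfolding C_usc_on_def by meson
  have "g u \<in> uminus ` interior C" if u: "u \<in> U \<inter> K" for u
  proof -
    obtain v c where "g u = v - c" "v \<in> uminus ` interior C" "c \<in> C"
      using U(3) u by blast
    then show ?thesis using neg_interior_diff[OF C] by simp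
  qed
  then show ?thesis using U(1,2) by blast
qed

section \<open>Existence of an equilibrium point\<close>


theorem theorem4p3:
  fixes C :: "'z::{topological_real_vector, t2_space} set"
    and K :: "'a::banach set"
    and F :: "'a \<Rightarrow> 'a \<Rightarrow> 'a \<Rightarrow> 'z"
  assumes reflexive: "reflexive_space TYPE('a)"
    and C: "pointed_convex_cone C" "interior C \<noteq> {}"
    and K: "K \<noteq> {}" "convex K" "closed K"
    and i: "\<forall>y\<in>K.
          net_closed TYPE('a \<times> 'a set) weak_topology C K (\<lambda>x. F x y x)
        \<or> C_usc_on weak_topology C K (\<lambda>x. F x y x)
        \<or> net_C_bounded TYPE('a \<times> 'a set) weak_topology C K (\<lambda>x. F x y x)"
    and ii: "\<forall>x\<in>K. C_convex_on C K (\<lambda>y. F x y x)"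
    and iii: "\<forall>x\<in>K. F x x x \<notin> uminus ` interior C"
    and iv: "\<exists>r>0. K \<inter> cball 0 r \<noteq> {} \<and>
        (\<forall>x\<in>K. norm x \<le> r \<longrightarrow> (\<exists>y0\<in>K. norm y0 < r \<and> F x y0 x \<in> uminus ` C))"
  shows "\<exists>x0\<in>K. \<forall>y\<in>K. F x0 y x0 \<notin> uminus ` interior C"
proof -
  obtain r where M_ne: "K \<inter> cball 0 r \<noteq> {}"
    and coercive: "\<And>x. x \<in> K \<Longrightarrow> norm x \<le> r \<Longrightarrow> \<exists>y0\<in>K. norm y0 < r \<and> F x y0 x \<in> uminus ` C"
    using iv by blast
  define M where "M = K \<inter> cball 0 r"
  define N where "N x = {y \<in> K. F x y x \<in> uminus ` interior C}" for x
  have M_conv: "convex M" unfolding M_def by (intro convex_Int K(2) convex_cball)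
  have M_compact: "compactin weak_topology M"
    using reflexive M_conv K(3) by (intro reflexive_weakly_compact) (auto simp: M_def)
  have nbhd: "\<exists>U. openin weak_topology U \<and> x \<in> U \<and> (\<forall>u\<in>U \<inter> K. F u y u \<in> uminus ` interior C)"
    if xy: "x \<in> K" "y \<in> K" and neg: "F x y x \<in> uminus ` interior C" for x y
  proof -
    from i xy(2) consider
        (closed) "net_closed TYPE('a \<times> 'a set) weak_topology C K (\<lambda>x. F x y x)"
      | (usc) "C_usc_on weak_topology C K (\<lambda>x. F x y x)"
      using net_C_bounded_imp_net_closed[OF C(1)] by blast
    then show ?thesis
    proof cases
      case closed then show ?thesis using net_closed_imp_nbhd[OF closed xy(1)] neg by simp
    next
      case usc then show ?thesis using C_usc_on_imp_nbhd[OF C(1) usc xy(1)] neg by simp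
    qed
  qed
  have "\<exists>x\<in>M. N x \<inter> M = {}"
  proof (rule Browder_Fan_maximal_element[OF openin_weak_imp_open M_compact M_conv])
    show "M \<noteq> {}" using M_ne by (simp add: M_def)
    show "convex (N x)" if "x \<in> M" for x
      unfolding N_def using that ii by (intro convex_neg_interior_sublevel[OF C(1) K(2)]) (simp add: M_def)
    show "x \<notin> N x" if "x \<in> M" for x using iii that by (simp add: N_def M_def)
    show "\<exists>U. openin weak_topology U \<and> x \<in> U \<and> (\<forall>u\<in>U \<inter> M. y \<in> N u)"
      if "x \<in> M" "y \<in> M" "y \<in> N x" for x y
      using nbhd[of x y] that by (fastforce simp: M_def N_def)
  qed
  then obtain x0 where x0: "x0 \<in> M" "N x0 \<inter> M = {}" by blast
  then have x0K: "x0 \<in> K" "norm x0 \<le> r" by (auto simp: M_def)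
  obtain y0 where y0: "y0 \<in> K" "norm y0 < r" "F x0 y0 x0 \<in> uminus ` C"
    using coercive[OF x0K] by blast
  have "F x0 y x0 \<notin> uminus ` interior C" if y: "y \<in> K" for y
  proof
    assume neg: "F x0 y x0 \<in> uminus ` interior C"
    \<comment> \<open>This weight keeps the combination inside the ball of radius \<open>r\<close>, and it is positive because
       \<open>norm y0 < r\<close> is strict.\<close>
    define t where "t = (r - norm y0) / (r - norm y0 + norm (y - y0))"
    have t: "0 < t" "t \<le> 1" using y0(2) by (auto simp: t_def add_pos_nonneg)
    have "t * norm (y - y0) \<le> r - norm y0"
    proof -
      have "t * norm (y - y0) = (r - norm y0) * (norm (y - y0) / (r - norm y0 + norm (y - y0)))"
        by (simp add: t_def)
      also have "\<dots> \<le> (r - norm y0) * 1"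
        using y0(2) by (intro mult_left_mono) (auto simp: divide_le_eq_1 add_pos_nonneg)
      finally show ?thesis by simp
    qed
    moreover have z: "t *\<^sub>R y + (1 - t) *\<^sub>R y0 = y0 + t *\<^sub>R (y - y0)" by (simp add: algebra_simps)
    ultimately have "norm (t *\<^sub>R y + (1 - t) *\<^sub>R y0) \<le> r"
      unfolding z using norm_triangle_ineq[of y0 "t *\<^sub>R (y - y0)"] t by simp
    moreover have "t *\<^sub>R y + (1 - t) *\<^sub>R y0 \<in> K"
      using convexD[OF K(2) y y0(1)] t by simp
    moreover have "F x0 (t *\<^sub>R y + (1 - t) *\<^sub>R y0) x0 \<in> uminus ` interior C"
      using C_convex_combination_neg_interior[OF C(1), of K "\<lambda>y. F x0 y x0" y y0 t]
        ii x0K(1) y y0 neg t by simp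
    ultimately have "t *\<^sub>R y + (1 - t) *\<^sub>R y0 \<in> N x0 \<inter> M" by (simp add: N_def M_def)
    with x0(2) show False by blast
  qed
  with x0K(1) show ?thesis by blast
qed

end
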